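(* Let $\mathbb F\in\{\mathbb R,\mathbb C\}$ and let $\mathcal S\subset \mathrm{Sym}_d(\mathbb F)$ be a spectrahedron of dimension $D$. Let $n\ge 2$ and let $W_1,\dots,W_n\in\mathcal S$ satisfy $\mathrm{tr}(W_j)=1$ and $\mathrm{tr}(W_j^2)=\gamma$ for all $j$. Then $$\max_{j,l\le n,\ j\neq l}\mathrm{tr}(W_jW_l)\ \ge\ \frac{n-\gamma d}{(n-1)d},$$ and if equality holds then $n\le D+1$, $\mathrm{tr}(W_jW_l)=\frac{n-\gamma d}{(n-1)d}$ for every $j\ne l$, and $\sum_{j=1}^n W_j=\frac nd I$. If $n>D+1$, then $$\max_{j,l\le n,\ j\neq l}\mathrm{tr}(W_jW_l)\ \ge\ \frac1d,$$ and if equality holds then $n\le 2D$.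
   Context: $\mathrm{Sym}_d(\mathbb F)$ denotes the real vector space of symmetric ($\mathbb F=\mathbb R$) or Hermitian ($\mathbb F=\mathbb C$) $d\times d$ matrices with the Hilbert–Schmidt inner product $\langle A,B\rangle=\mathrm{tr}(AB)$. A spectrahedron in $\mathrm{Sym}_d(\mathbb F)$ is the intersection of a real affine subspace of $\mathrm{Sym}_d(\mathbb F)$ with the cone of positive semidefinite matrices; its dimension is the real dimension of that affine subspace.
   Formalization: The conclusions n ≤ D+1 and n ≤ 2D are proved when some W_j differs from I/d (automatic if the W_j are distinct); if all W_j = I/d, e.g. S = {I/d}, D = 0, n = 2, both equalities hold but these bounds fail. *)

theory Defs
  imports "HOL-Analysis.Analysis"
begin

text \<open>
  Both cases of the scalar field are treated inside the complex matrices: \<open>F\<close> is either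
  \<open>\<real> :: complex set\<close> or \<open>UNIV :: complex set\<close>, and matrices and vectors over the scalar field are
  those with all entries in \<open>F\<close>. The order \<open>d\<close> is \<open>CARD('d)\<close>. On \<^typ>\<open>complex^'d^'d\<close> the library
  notions \<^const>\<open>affine\<close> and \<^const>\<open>aff_dim\<close> refer to the real vector space structure.
\<close>

text \<open>For \<open>F = \<real>\<close> the conjugation acts trivially, so these are the real symmetric matrices.\<close>

definition Sym :: "complex set \<Rightarrow> (complex^'d^'d) set" where
  "Sym F = {A. (\<forall>i j. A $ i $ j \<in> F) \<and> (\<forall>i j. A $ i $ j = cnj (A $ j $ i))}"

text \<open>The trace of a product of two Hermitian matrices is real; \<^const>\<open>Re\<close> only changes its type.\<close>

definition hs_inner :: "complex^'d^'d \<Rightarrow> complex^'d^'d \<Rightarrow> real" where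
  "hs_inner A B = Re (trace (A ** B))"

definition psd_cone :: "complex set \<Rightarrow> (complex^'d^'d) set" where
  "psd_cone F = {A \<in> Sym F. \<forall>v :: complex^'d. (\<forall>i. v $ i \<in> F) \<longrightarrow>
                   0 \<le> Re (\<Sum>i\<in>UNIV. cnj (v $ i) * (A *v v) $ i)}"

text \<open>
  The dimension is that of the affine subspace presenting the spectrahedron, which may exceed the
  dimension of the affine hull of the spectrahedron. Hence it is a relation between \<open>S\<close> and \<open>D\<close>.
\<close>

definition spectrahedron_of_dim :: "complex set \<Rightarrow> nat \<Rightarrow> (complex^'d^'d) set \<Rightarrow> bool" where
  "spectrahedron_of_dim F D S \<longleftrightarrow>
     (\<exists>L. affine L \<and> L \<subseteq> Sym F \<and> aff_dim L = int D \<and> S = L \<inter> psd_cone F)"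

end

theory Submission
  imports Defs
begin

text \<open>
  Subtracting \<open>I/d\<close> turns the \<open>W j\<close> into traceless vectors \<open>V j\<close> of common squared norm
  \<open>\<gamma> - 1/d\<close> whose inner products are those of the \<open>W j\<close> shifted by \<open>- 1/d\<close>. The first bound and
  its equality case are \<open>0 \<le> \<parallel>\<Sum>V j\<parallel>\<^sup>2\<close>. By Radon's theorem, vectors with pairwise negative inner
  products are affinely independent, because a common point of the convex hulls of two disjoint
  subfamilies would have negative squared norm; this bounds their number by \<open>D + 1\<close>. If the inner
  products are only nonpositive and \<open>n > D + 1\<close>, the common point is \<open>0\<close>, so the translated affine
  space is a linear space of dimension \<open>D\<close>, and it contains at most \<open>2 * D\<close> nonzero vectors with
  pairwise nonpositive inner products (project along one of them and induct on the dimension).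
\<close>

text \<open>Half-spaces are convex, so a bound valid on \<open>A\<close> and \<open>B\<close> passes
  to the hulls one argument at a time.\<close>

lemma convex_hull_inner_le:
  fixes A B :: "'a::real_inner set"
  assumes "\<And>a b. a \<in> A \<Longrightarrow> b \<in> B \<Longrightarrow> a \<bullet> b \<le> c" "x \<in> convex hull A" "y \<in> convex hull B"
  shows "x \<bullet> y \<le> c"
proof -
  have "convex hull A \<subseteq> {x. b \<bullet> x \<le> c}" if "b \<in> B" for b
    using assms(1) that by (intro hull_minimal convex_halfspace_le) (auto simp: inner_commute)
  then have "convex hull B \<subseteq> {y. x \<bullet> y \<le> c}"
    using assms(2) by (intro hull_minimal convex_halfspace_le) (auto simp: inner_commute)
  then show ?thesis using assms(3) by auto
qed

lemma convex_hull_inner_less: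
  fixes A B :: "'a::real_inner set"
  assumes "\<And>a b. a \<in> A \<Longrightarrow> b \<in> B \<Longrightarrow> a \<bullet> b < c" "x \<in> convex hull A" "y \<in> convex hull B"
  shows "x \<bullet> y < c"
proof -
  have "convex hull A \<subseteq> {x. b \<bullet> x < c}" if "b \<in> B" for b
    using assms(1) that by (intro hull_minimal convex_halfspace_lt) (auto simp: inner_commute)
  then have "convex hull B \<subseteq> {y. x \<bullet> y < c}"
    using assms(2) by (intro hull_minimal convex_halfspace_lt) (auto simp: inner_commute)
  then show ?thesis using assms(3) by auto
qed

lemma affine_independent_if_pairwise_neg:
  fixes T :: "'a::euclidean_space set"
  assumes "finite T" "pairwise (\<lambda>x y. x \<bullet> y < 0) T"
  shows "\<not> affine_dependent T"
proof
  assume "affine_dependent T"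
  then obtain A B z where AB: "A \<inter> B = {}" "A \<union> B = T"
    and z: "z \<in> convex hull A" "z \<in> convex hull B"
    using Radon_partition[OF assms(1)] by blast
  have "a \<bullet> b < 0" if "a \<in> A" "b \<in> B" for a b
    using pairwiseD[OF assms(2), of a b] AB that by blast
  then have "z \<bullet> z < 0" by (rule convex_hull_inner_less[OF _ z])
  then show False using inner_ge_zero[of z] by linarith
qed

lemma zero_in_affine_hull_if_pairwise_nonpos:
  fixes T :: "'a::euclidean_space set"
  assumes "finite T" "pairwise (\<lambda>x y. x \<bullet> y \<le> 0) T" "affine_dependent T"
  shows "0 \<in> affine hull T"
proof -
  obtain A B z where AB: "A \<inter> B = {}" "A \<union> B = T"
    and z: "z \<in> convex hull A" "z \<in> convex hull B"
    using Radon_partition[OF assms(1,3)] by blast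
  have "a \<bullet> b \<le> 0" if "a \<in> A" "b \<in> B" for a b
    using pairwiseD[OF assms(2), of a b] AB that by blast
  then have "z \<bullet> z \<le> 0" by (rule convex_hull_inner_le[OF _ z])
  then have "z = 0" using inner_ge_zero[of z] by (metis antisym inner_eq_zero_iff)
  moreover have "convex hull A \<subseteq> affine hull T"
    using AB(2) by (meson Un_upper1 convex_hull_subset_affine_hull hull_mono order_trans)
  ultimately show ?thesis using z(1) by auto
qed

lemma card_le_aff_dim_if_affine_independent:
  fixes T L :: "'a::euclidean_space set"
  assumes "\<not> affine_dependent T" "T \<subseteq> L" "aff_dim L = int D"
  shows "card T \<le> D + 1"
proof -
  have "int (card T) = aff_dim T + 1" by (rule aff_dim_affine_independent[OF assms(1)])
  then show ?thesis using aff_dim_subset[OF assms(2)] assms(3) by linarith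
qed

text \<open>Projecting along one vector \<open>v\<close> costs \<open>v\<close> itself and at most
  one further vector, so each drop in dimension uses up at most two. An orthonormal basis together
  with its negatives attains the bound.\<close>

lemma card_pairwise_nonpos_le:
  fixes T S :: "'a::euclidean_space set"
  assumes "finite T" "subspace S" "T \<subseteq> S" "0 \<notin> T" "pairwise (\<lambda>x y. x \<bullet> y \<le> 0) T"
  shows "card T \<le> 2 * dim S"
  using assms
proof (induction "dim S" arbitrary: S T rule: less_induct)
  case less
  show ?case
  proof (cases "T = {}")
    case False
    then obtain v where v: "v \<in> T" by auto
    then have v0: "v \<noteq> 0" "v \<in> S" using less.prems by auto
    then have vv: "v \<bullet> v > 0" by simp
    have nonpos: "x \<bullet> y \<le> 0" if "x \<in> T" "y \<in> T" "x \<noteq> y" for x y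
      using less.prems(5) that by (auto simp: pairwise_def)
    \<comment> \<open>\<open>u x\<close> is the component of \<open>x\<close> orthogonal to
      \<open>v\<close>. By \<open>uu\<close>, projecting subtracts a product of two nonpositive
      numbers over \<open>v \<bullet> v\<close>, so inner products stay nonpositive.\<close>
    define u where "u x = x - ((x \<bullet> v) / (v \<bullet> v)) *\<^sub>R v" for x
    have uu: "u x \<bullet> u y = x \<bullet> y - (x \<bullet> v) * (y \<bullet> v) / (v \<bullet> v)" for x y
      using v0 by (simp add: u_def inner_diff inner_commute)
    have u_nonpos: "u x \<bullet> u y \<le> 0" if "x \<in> T - {v}" "y \<in> T - {v}" "x \<noteq> y" for x y
    proof -
      have "0 \<le> (x \<bullet> v) * (y \<bullet> v) / (v \<bullet> v)"
        using nonpos[of x v] nonpos[of y v] that v vv by (simp add: mult_nonpos_nonpos)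
      then show ?thesis using nonpos[of x y] that by (simp add: uu)
    qed
    define S' where "S' = S \<inter> {x. v \<bullet> x = 0}"
    have S': "subspace S'"
      unfolding S'_def by (intro subspace_inter less.prems(2) subspace_hyperplane)
    have "v \<notin> S'" using v0 by (simp add: S'_def)
    then have "S' \<subset> S" using v0 unfolding S'_def by blast
    then have "span S' \<subset> span S" using less.prems(2) S' by (simp add: span_eq_iff[THEN iffD2])
    then have dim: "dim S' < dim S" by (rule dim_psubset)
    \<comment> \<open>\<open>Z\<close> collects the other multiples of \<open>v\<close>. Being
      nonzero, they are negative multiples, and two distinct ones would have a positive inner
      product.\<close>
    define Z where "Z = {x \<in> T - {v}. u x = 0}"
    define N where "N = {x \<in> T - {v}. u x \<noteq> 0}"
    have fin: "finite Z" "finite N" using less.prems(1) by (auto simp: Z_def N_def)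
    have "card Z \<le> 1"
    proof -
      have "x = y" if "x \<in> Z" "y \<in> Z" for x y
      proof (rule ccontr)
        assume "x \<noteq> y"
        have xy: "x = ((x \<bullet> v) / (v \<bullet> v)) *\<^sub>R v" "y = ((y \<bullet> v) / (v \<bullet> v)) *\<^sub>R v"
          using that by (auto simp: Z_def u_def)
        have "x \<bullet> v \<le> 0" "y \<bullet> v \<le> 0" using that nonpos[OF _ v] by (auto simp: Z_def)
        moreover have "x \<bullet> v \<noteq> 0" "y \<bullet> v \<noteq> 0"
          using xy that less.prems(4) by (auto simp: Z_def)
        ultimately have "(x \<bullet> v) * (y \<bullet> v) > 0" by (simp add: mult_neg_neg)
        moreover have "x \<bullet> y = (x \<bullet> v) * (y \<bullet> v) / (v \<bullet> v)"
          using uu[of x y] that by (simp add: Z_def)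
        ultimately have "x \<bullet> y > 0" using vv by simp
        then show False using nonpos[of x y] that \<open>x \<noteq> y\<close> by (auto simp: Z_def)
      qed
      then show ?thesis by (simp add: card_le_Suc0_iff_eq[OF fin(1)])
    qed
    \<comment> \<open>Distinct vectors with a common image would force
      \<open>u x \<bullet> u x \<le> 0\<close>, hence \<open>u x = 0\<close>.\<close>
    moreover have "inj_on u N"
    proof (rule inj_onI, rule ccontr)
      fix x y assume xy: "x \<in> N" "y \<in> N" "u x = u y" "x \<noteq> y"
      then have "u x \<bullet> u x \<le> 0" using u_nonpos[of x y] by (auto simp: N_def)
      then show False using xy(1) by (simp add: N_def flip: inner_gt_zero_iff)
    qed
    moreover have "card (u ` N) \<le> 2 * dim S'"
    proof (rule less.hyps[OF dim _ S'])
      show "u ` N \<subseteq> S'"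
        using v0 less.prems(2,3)
        by (auto simp: N_def S'_def u_def inner_diff inner_commute
            intro!: subspace_diff subspace_scale)
      show "pairwise (\<lambda>x y. x \<bullet> y \<le> 0) (u ` N)"
        using u_nonpos by (auto simp: pairwise_def N_def)
    qed (use fin in \<open>auto simp: N_def\<close>)
    moreover have "T = insert v (Z \<union> N)" using v by (auto simp: Z_def N_def)
    then have "card T \<le> 1 + (card Z + card N)"
      using card_Un_le[of Z N] fin by (simp add: card_insert_if)
    ultimately show ?thesis using dim by (simp add: card_image)
  qed simp
qed

text \<open>Writing each off-diagonal inner product as \<open>m\<close> minus a nonnegative gap and
  summing over all pairs, the total gap plus the squared norm of \<open>sum V I\<close> equals
  n((n-1)m + r), where n is \<open>card I\<close>. Both terms on the left are nonnegative, and both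
  vanish in the equality case.\<close>

lemma equal_norm_pairwise_bound:
  fixes V :: "'i \<Rightarrow> 'a::real_inner"
  assumes "finite I" "card I \<ge> 2" and norm: "\<And>j. j \<in> I \<Longrightarrow> V j \<bullet> V j = r"
    and le: "\<And>j l. j \<in> I \<Longrightarrow> l \<in> I \<Longrightarrow> j \<noteq> l \<Longrightarrow> V j \<bullet> V l \<le> m"
  shows "- r / (real (card I) - 1) \<le> m"
    and "m = - r / (real (card I) - 1) \<Longrightarrow> sum V I = 0"
    and "m = - r / (real (card I) - 1) \<Longrightarrow> j \<in> I \<Longrightarrow> l \<in> I \<Longrightarrow> j \<noteq> l \<Longrightarrow> V j \<bullet> V l = m"
proof -
  let ?n = "real (card I)"
  let ?gap = "\<lambda>j l. if j = l then 0 else m - V j \<bullet> V l"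
  have gap0: "0 \<le> ?gap j l" if "j \<in> I" "l \<in> I" for j l using le that by simp
  have "(\<Sum>l\<in>I. ?gap j l + V j \<bullet> V l) = (?n - 1) * m + r" if j: "j \<in> I" for j
  proof -
    have "(\<Sum>l\<in>I. ?gap j l + V j \<bullet> V l)
        = (r + (\<Sum>l\<in>I-{j}. ?gap j l + V j \<bullet> V l))"
      using j assms(1) norm by (subst sum.remove[of _ j]) auto
    also have "(\<Sum>l\<in>I-{j}. ?gap j l + V j \<bullet> V l) = (\<Sum>l\<in>I-{j}. m)"
      by (rule sum.cong) auto
    also have "\<dots> = (?n - 1) * m" using j assms(1,2) by (simp add: of_nat_diff)
    finally show ?thesis by simp
  qed
  then have "(\<Sum>j\<in>I. \<Sum>l\<in>I. ?gap j l + V j \<bullet> V l) = ?n * ((?n - 1) * m + r)" by simp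
  moreover have "(\<Sum>j\<in>I. \<Sum>l\<in>I. V j \<bullet> V l) = sum V I \<bullet> sum V I"
    by (simp add: inner_sum_left inner_sum_right) (rule sum.swap)
  ultimately have eq:
    "(\<Sum>j\<in>I. \<Sum>l\<in>I. ?gap j l) + sum V I \<bullet> sum V I = ?n * ((?n - 1) * m + r)"
    by (simp add: sum.distrib)
  have gaps: "(\<Sum>j\<in>I. \<Sum>l\<in>I. ?gap j l) \<ge> 0"
    using gap0 by (intro sum_nonneg) auto
  then have "?n * ((?n - 1) * m + r) \<ge> 0" using eq inner_ge_zero[of "sum V I"] by linarith
  then have "(?n - 1) * m + r \<ge> 0" using assms(2) by (simp add: zero_le_mult_iff)
  then show "- r / (?n - 1) \<le> m" using assms(2) by (simp add: field_simps)
  assume "m = - r / (?n - 1)"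
  then have "(?n - 1) * m + r = 0" using assms(2) by (simp add: field_simps)
  then have zero: "(\<Sum>j\<in>I. \<Sum>l\<in>I. ?gap j l) = 0" "sum V I \<bullet> sum V I = 0"
    using eq gaps inner_ge_zero[of "sum V I"] by (simp_all only: mult_zero_right)
  then show "sum V I = 0" by simp
  assume jl: "j \<in> I" "l \<in> I" "j \<noteq> l"
  have "(\<Sum>l\<in>I. ?gap j l) = 0"
    using zero(1) jl(1) gap0 assms(1)
    by (subst (asm) sum_nonneg_eq_0_iff) (auto intro!: sum_nonneg)
  then have "?gap j l = 0"
    using jl(1,2) gap0 assms(1) by (subst (asm) sum_nonneg_eq_0_iff) auto
  then show "V j \<bullet> V l = m" using jl(3) by simp
qed

text \<open>Hermitian symmetry makes the trace a sum of terms
  \<open>A $ i $ j * cnj (B $ i $ j)\<close>, and conjugation merely swaps the two indices, so the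
  value is real. This lets Euclidean geometry be applied to the trace form.\<close>

lemma trace_mult_Sym:
  fixes A B :: "complex^'d^'d"
  assumes "A \<in> Sym F" "B \<in> Sym F"
  shows "trace (A ** B) = complex_of_real (A \<bullet> B)"
proof -
  have cnj: "cnj (A $ i $ j) = A $ j $ i" "cnj (B $ i $ j) = B $ j $ i" for i j
    using assms unfolding Sym_def by (metis (mono_tags, lifting) complex_cnj_cnj mem_Collect_eq)+
  have tr: "trace (A ** B) = (\<Sum>i\<in>UNIV. \<Sum>j\<in>UNIV. A $ i $ j * cnj (B $ i $ j))"
    by (simp add: trace_def matrix_matrix_mult_def cnj)
  have "cnj (trace (A ** B)) = (\<Sum>i\<in>UNIV. \<Sum>j\<in>UNIV. A $ j $ i * cnj (B $ j $ i))"
    unfolding tr by (simp add: cnj)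
  also have "\<dots> = trace (A ** B)" unfolding tr by (rule sum.swap)
  finally have "trace (A ** B) \<in> \<real>" by (simp add: Reals_cnj_iff)
  moreover have "Re (trace (A ** B)) = A \<bullet> B"
    unfolding tr by (simp add: inner_vec_def inner_complex_def)
  ultimately show ?thesis by (metis of_real_Re)
qed

lemma inner_mat_1:
  fixes A :: "complex^'d^'d"
  shows "A \<bullet> mat 1 = Re (trace A)"
proof -
  have "A $ i $ j \<bullet> (mat 1 :: complex^'d^'d) $ i $ j = (if j = i then Re (A $ i $ j) else 0)"
    for i j
    by (simp add: mat_def inner_complex_def)
  then show ?thesis by (simp add: inner_vec_def trace_def)
qed

text \<open>The bounds on \<open>n\<close> in the equality cases assume that some \<open>W j\<close>
  differs from I/d: for the constant family I/d both equalities hold for every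
  \<open>n \<ge> 2\<close>, whatever \<open>D\<close> is.\<close>

theorem theorem2p7:
  fixes F :: "complex set"
    and S :: "(complex^'d^'d) set"
    and D n :: nat
    and W :: "nat \<Rightarrow> complex^'d^'d"
    and \<gamma> d M :: real
  assumes "F = \<real> \<or> F = UNIV"
    and "spectrahedron_of_dim F D S"
    and "n \<ge> 2"
    and "\<And>j. j \<in> {1..n} \<Longrightarrow> W j \<in> S"
    and "\<And>j. j \<in> {1..n} \<Longrightarrow> trace (W j) = 1"
    and "\<And>j. j \<in> {1..n} \<Longrightarrow> trace (W j ** W j) = complex_of_real \<gamma>"
  defines "d \<equiv> real CARD('d)"
    and "M \<equiv> Max {hs_inner (W j) (W l) | j l. j \<in> {1..n} \<and> l \<in> {1..n} \<and> j \<noteq> l}"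
  shows "M \<ge> (real n - \<gamma> * d) / ((real n - 1) * d) \<and>
         (M = (real n - \<gamma> * d) / ((real n - 1) * d) \<longrightarrow>
            ((\<exists>j\<in>{1..n}. W j \<noteq> (1 / d) *\<^sub>R mat 1) \<longrightarrow> n \<le> D + 1) \<and>
            (\<forall>j\<in>{1..n}. \<forall>l\<in>{1..n}. j \<noteq> l \<longrightarrow>
               trace (W j ** W l) = complex_of_real ((real n - \<gamma> * d) / ((real n - 1) * d))) \<and>
            (\<Sum>j=1..n. W j) = (real n / d) *\<^sub>R mat 1) \<and>
         (n > D + 1 \<longrightarrow>
            M \<ge> 1 / d \<and>
            (M = 1 / d \<longrightarrow> (\<exists>j\<in>{1..n}. W j \<noteq> (1 / d) *\<^sub>R mat 1) \<longrightarrow> n \<le> 2 * D))"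
proof -
  obtain L where L: "affine L" "L \<subseteq> Sym F" "aff_dim L = int D" "S = L \<inter> psd_cone F"
    using assms(2) unfolding spectrahedron_of_dim_def by auto
  let ?I = "{1..n}"
  let ?c = "(1 / d) *\<^sub>R mat 1 :: complex^'d^'d"
  let ?b = "(real n - \<gamma> * d) / ((real n - 1) * d)"
  have d: "d > 0" by (simp add: d_def)
  have WL: "W j \<in> L" "W j \<in> Sym F" if "j \<in> ?I" for j
    using assms(4)[OF that] L by auto
  have tr: "trace (W j ** W l) = complex_of_real (W j \<bullet> W l)" if "j \<in> ?I" "l \<in> ?I" for j l
    using that WL by (intro trace_mult_Sym)
  define V where "V j = W j - ?c" for j
  have one: "mat 1 \<bullet> (mat 1 :: complex^'d^'d) = d"
    unfolding inner_mat_1 by (simp add: trace_def mat_def d_def)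
  have W1: "W j \<bullet> mat 1 = 1" if "j \<in> ?I" for j
    using assms(5)[OF that] by (simp add: inner_mat_1)
  have V_inner: "V j \<bullet> V l = W j \<bullet> W l - 1 / d" if "j \<in> ?I" "l \<in> ?I" for j l
    using W1[OF that(1)] W1[OF that(2)] one d
    by (simp add: V_def inner_diff inner_commute)
  define r where "r = \<gamma> - 1 / d"
  have norm: "V j \<bullet> V j = r" if "j \<in> ?I" for j
    using assms(6)[OF that] tr[OF that that] V_inner[OF that that] by (simp add: r_def)
  have M_le: "hs_inner (W j) (W l) \<le> M" if "j \<in> ?I" "l \<in> ?I" "j \<noteq> l" for j l
  proof -
    have "finite ((\<lambda>(j, l). hs_inner (W j) (W l)) ` (?I \<times> ?I))" by simp
    then have "finite {hs_inner (W j) (W l) | j l. j \<in> ?I \<and> l \<in> ?I \<and> j \<noteq> l}"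
      by (rule rev_finite_subset) auto
    then show ?thesis unfolding M_def using that by (intro Max_ge) auto
  qed
  have le: "V j \<bullet> V l \<le> M - 1 / d" if "j \<in> ?I" "l \<in> ?I" "j \<noteq> l" for j l
    using M_le[OF that] tr[OF that(1,2)] V_inner[OF that(1,2)] by (simp add: hs_inner_def)
  \<comment> \<open>The shift by \<open>1 / d\<close> turns the claimed bound into the one for
    vectors of equal norm.\<close>
  have b: "?b - 1 / d = - r / (real (card ?I) - 1)"
    using d assms(3) by (simp add: r_def field_simps)
  have "card ?I \<ge> 2" using assms(3) by simp
  note bound = equal_norm_pairwise_bound[where V = V, OF finite_atLeastAtMost this norm le]
  have sum_V: "sum V ?I = 0" if "M - 1 / d = - r / (real (card ?I) - 1)"
    using that by (intro bound(2))
  have V_eq: "V j \<bullet> V l = M - 1 / d"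
    if "M - 1 / d = - r / (real (card ?I) - 1)" "j \<in> ?I" "l \<in> ?I" "j \<noteq> l" for j l
    using that by (intro bound(3))

  define T where "T = V ` ?I"
  define L' where "L' = (+) (- ?c) ` L"
  have L': "affine L'" "aff_dim L' = int D"
    unfolding L'_def using L(1,3) affine_translation[of L "- ?c"] aff_dim_translation_eq[of "- ?c" L]
    by (simp_all only:)
  have T: "finite T" "T \<subseteq> L'" using WL by (auto simp: T_def L'_def V_def)
  \<comment> \<open>All \<open>V j\<close> share the squared norm \<open>r\<close>, so a single
    nonzero one makes \<open>r\<close> positive.\<close>
  have r_pos: "r > 0" if "\<exists>j\<in>?I. W j \<noteq> ?c"
  proof -
    obtain j where "j \<in> ?I" "V j \<noteq> 0" using \<open>\<exists>j\<in>?I. W j \<noteq> ?c\<close> by (auto simp: V_def)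
    then show ?thesis using norm[of j] by (metis inner_gt_zero_iff)
  qed
  \<comment> \<open>Coinciding vectors would have inner product \<open>r\<close>; thus passing from
    the indexed family to the set \<open>T\<close> loses no index.\<close>
  have card_T: "card T = n" if "\<And>j l. j \<in> ?I \<Longrightarrow> l \<in> ?I \<Longrightarrow> j \<noteq> l \<Longrightarrow> V j \<bullet> V l < r"
  proof -
    have "inj_on V ?I"
      using that norm by (intro inj_onI) (metis less_irrefl)
    then show ?thesis by (simp add: T_def card_image)
  qed
  have neg: "n \<le> D + 1"
    if neg: "\<And>j l. j \<in> ?I \<Longrightarrow> l \<in> ?I \<Longrightarrow> j \<noteq> l \<Longrightarrow> V j \<bullet> V l < 0"
  proof -
    have "r \<ge> 0" using norm[of 1] assms(3) inner_ge_zero[of "V 1"] by simp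
    then have "card T = n" using neg by (intro card_T) (meson less_le_trans)
    moreover have "pairwise (\<lambda>x y. x \<bullet> y < 0) T"
      unfolding T_def by (rule pairwise_imageI) (rule neg)
    ultimately show ?thesis
      using card_le_aff_dim_if_affine_independent[OF affine_independent_if_pairwise_neg T(2) L'(2)]
        T(1) by simp
  qed

  have "?b \<le> M" using bound(1) b by linarith
  moreover have "(\<exists>j\<in>?I. W j \<noteq> ?c) \<longrightarrow> n \<le> D + 1"
    and "\<forall>j\<in>?I. \<forall>l\<in>?I. j \<noteq> l \<longrightarrow> trace (W j ** W l) = complex_of_real ?b"
    and "(\<Sum>j=1..n. W j) = (real n / d) *\<^sub>R mat 1" if "M = ?b"
  proof -
    have m: "M - 1 / d = - r / (real (card ?I) - 1)" using that b by simp
    have "(\<Sum>j=1..n. V j) = 0" by (rule sum_V[OF m])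
    then have "(\<Sum>j=1..n. W j) = real n *\<^sub>R ?c"
      by (simp only: V_def sum_subtractf sum_constant_scaleR card_atLeastAtMost
          diff_Suc_1 eq_iff_diff_eq_0[symmetric])
    then show "(\<Sum>j=1..n. W j) = (real n / d) *\<^sub>R mat 1"
      by (simp only: scaleR_scaleR times_divide_eq_right mult_1_right)
    show "\<forall>j\<in>?I. \<forall>l\<in>?I. j \<noteq> l \<longrightarrow> trace (W j ** W l) = complex_of_real ?b"
      using V_eq[OF m] V_inner tr that by simp
    show "(\<exists>j\<in>?I. W j \<noteq> ?c) \<longrightarrow> n \<le> D + 1"
    proof
      assume "\<exists>j\<in>?I. W j \<noteq> ?c"
      \<comment> \<open>In the equality case this is the common inner product of distinct
        \<open>V j\<close>, so \<open>neg\<close> applies.\<close>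
      then have "- r / (real (card ?I) - 1) < 0"
        using r_pos assms(3) by (simp add: divide_neg_pos)
      then show "n \<le> D + 1" using V_eq[OF m] m by (intro neg) simp
    qed
  qed
  moreover have "1 / d \<le> M" if "n > D + 1"
  proof (rule ccontr)
    assume "\<not> 1 / d \<le> M"
    then have "n \<le> D + 1" using le by (intro neg) (meson diff_less_0_iff_less le_less_trans not_le)
    then show False using that by simp
  qed
  moreover have "n \<le> 2 * D" if "n > D + 1" "M = 1 / d" "\<exists>j\<in>?I. W j \<noteq> ?c"
  proof -
    have nonpos: "V j \<bullet> V l \<le> 0" if "j \<in> ?I" "l \<in> ?I" "j \<noteq> l" for j l
      using le[OF that] \<open>M = 1 / d\<close> by simp
    have r: "r > 0" by (rule r_pos[OF that(3)])
    have card: "card T = n" using nonpos r by (intro card_T) (meson le_less_trans)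
    have pw: "pairwise (\<lambda>x y. x \<bullet> y \<le> 0) T"
      unfolding T_def by (rule pairwise_imageI) (rule nonpos)
    \<comment> \<open>\<open>T\<close> has more than \<open>D + 1\<close> points inside the
      \<open>D\<close>-dimensional \<open>L'\<close>.\<close>
    have "affine_dependent T"
      using card_le_aff_dim_if_affine_independent[OF _ T(2) L'(2)] card that(1) by fastforce
    then have "0 \<in> affine hull T"
      by (rule zero_in_affine_hull_if_pairwise_nonpos[OF T(1) pw])
    \<comment> \<open>Containing \<open>0\<close> makes the affine \<open>L'\<close> a subspace,
      whose linear dimension is then its affine dimension \<open>D\<close>.\<close>
    then have "0 \<in> L'" using hull_minimal[of T L' affine] T(2) L'(1) by auto
    then have "subspace L'" "dim L' = D"
      using L' by (simp_all add: subspace_affine aff_dim_zero hull_inc)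
    moreover have "0 \<notin> T"
      using norm r by (force simp: T_def)
    ultimately show ?thesis using card_pairwise_nonpos_le[OF T(1) _ T(2) _ pw] card by simp
  qed
  ultimately show ?thesis by blast
qed

end
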